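(* Let $k \geq 2$ be an integer and let $G$ be a connected graph on $n$ vertices such that $d(x) + d(y) \geq n - k + 1$ for every induced subgraph $H$ of $G$ that is isomorphic to $K_{1,2} \cup K_1$, or to a graph of the form $(K_{1,2} \cup K_1) + e$, or to $K_{1,3} + e$, and for every pair of distinct nonadjacent vertices $x, y$ of $H$. Then $G$ has a spanning $k$-ended tree.
   Context: All graphs are finite and undirected, with no loops or multiple edges. For a vertex $v$ of $G$, $d(v)$ denotes the degree of $v$ in $G$ (not in the induced subgraph). $K_m$ is the complete graph on $m$ vertices, $K_{m,n}$ is the complete bipartite graph with parts of sizes $m$ and $n$, $\cup$ denotes disjoint union of graphs, and $W + e$ denotes a graph obtained from $W$ by adding an edge $e$ joining two nonadjacent vertices of $W$; "a graph of the form $W+e$" ranges over all choices of such an edge $e$. A leaf of a tree is a vertex of degree one in the tree. For an integer $k \geq 2$, a $k$-ended tree is a tree with at most $k$ leaves; a spanning $k$-ended tree of $G$ is a spanning tree of $G$ that is a $k$-ended tree. *)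

theory Defs
  imports "Graph_Theory.Graph_Theory"
begin

text \<open>
  A finite simple undirected graph is a \<^locale>\<open>pair_graph\<close>: every edge between \<open>u\<close> and \<open>v\<close>
  is the pair of arcs \<open>(u, v)\<close> and \<open>(v, u)\<close>.
\<close>

text \<open>Every edge at \<open>v\<close> contributes exactly one arc leaving \<open>v\<close>.\<close>

definition vertex_degree :: "'a pair_pre_digraph \<Rightarrow> 'a \<Rightarrow> nat" where
  "vertex_degree G v = out_degree (with_proj G) v"

text \<open>
  The constants \<^const>\<open>forest\<close>, \<^const>\<open>tree\<close> and \<^const>\<open>spanning_tree\<close> cannot be used for
  undirected graphs: \<^const>\<open>pre_digraph.cycle\<close> is a directed notion, so the two arcs of a single
  edge already form a cycle, of length 2. In a \<^locale>\<open>pair_graph\<close> the undirected cycles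
  are the directed ones of length at least 3.
\<close>

definition undirected_tree :: "'a pair_pre_digraph \<Rightarrow> bool" where
  "undirected_tree T \<longleftrightarrow> pair_graph T \<and> Digraph_Component.connected (with_proj T)
     \<and> \<not> (\<exists>p. pre_digraph.cycle (with_proj T) p \<and> length p \<ge> 3)"

definition leaves :: "'a pair_pre_digraph \<Rightarrow> 'a set" where
  "leaves T = {v \<in> pverts T. vertex_degree T v = 1}"

definition k_ended_tree :: "nat \<Rightarrow> 'a pair_pre_digraph \<Rightarrow> bool" where
  "k_ended_tree k T \<longleftrightarrow> undirected_tree T \<and> card (leaves T) \<le> k"

definition spanning_k_ended_tree :: "nat \<Rightarrow> 'a pair_pre_digraph \<Rightarrow> 'a pair_pre_digraph \<Rightarrow> bool" where
  "spanning_k_ended_tree k T G \<longleftrightarrow> k_ended_tree k T \<and> spanning (with_proj T) (with_proj G)"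

text \<open>
  Like \<^const>\<open>complete_digraph\<close> and \<^const>\<open>complete_bipartite_digraph\<close>, the following two
  predicates say that a graph is \<^emph>\<open>a\<close> graph of the given shape.
\<close>

definition K12_Un_K1 :: "'a pair_pre_digraph \<Rightarrow> bool" where
  "K12_Un_K1 W \<longleftrightarrow> (\<exists>A B. complete_bipartite_digraph 1 2 (with_proj A)
     \<and> complete_digraph 1 (with_proj B)
     \<and> pverts A \<inter> pverts B = {}
     \<and> W = \<lparr> pverts = pverts A \<union> pverts B, parcs = parcs A \<union> parcs B \<rparr>)"

definition K13 :: "'a pair_pre_digraph \<Rightarrow> bool" where
  "K13 W \<longleftrightarrow> complete_bipartite_digraph 1 3 (with_proj W)"

definition is_plus_edge :: "'a pair_pre_digraph \<Rightarrow> 'a pair_pre_digraph \<Rightarrow> bool" where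
  "is_plus_edge W W' \<longleftrightarrow> (\<exists>u v. u \<in> pverts W \<and> v \<in> pverts W \<and> u \<noteq> v \<and> (u, v) \<notin> parcs W
     \<and> W' = \<lparr> pverts = pverts W, parcs = parcs W \<union> {(u, v), (v, u)} \<rparr>)"

text \<open>Every \<open>H\<close> has its isomorphic copies on its own vertex type, so \<open>W\<close> can be taken there.\<close>

definition special_graph :: "'a pair_pre_digraph \<Rightarrow> bool" where
  "special_graph H \<longleftrightarrow>
     (\<exists>W :: 'a pair_pre_digraph. digraph_iso (with_proj H) (with_proj W)
        \<and> (K12_Un_K1 W
           \<or> (\<exists>W\<^sub>0. K12_Un_K1 W\<^sub>0 \<and> is_plus_edge W\<^sub>0 W)
           \<or> (\<exists>W\<^sub>0. K13 W\<^sub>0 \<and> is_plus_edge W\<^sub>0 W)))"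

end

theory Submission
  imports Defs
begin

text \<open>
  Among all spanning trees of \<open>G\<close> take one with the fewest leaves, \<open>l\<close> of them, and suppose that
  \<open>l > k\<close>, so that \<open>l \<ge> 3\<close>. Minimality has two consequences.

  Leaves of the tree are pairwise nonadjacent in \<open>G\<close> (\<open>leaves_nonadjacent\<close>): an edge between two of
  them could be exchanged for an edge at a branch vertex of the tree path between them.

  Any two leaves \<open>x\<close> and \<open>y\<close> satisfy \<open>d(x) + d(y) \<le> n - l + 1 \<le> n - k\<close> (\<open>leaf_degree_sum\<close>). Send each
  neighbour \<open>z\<close> of \<open>x\<close> to the vertex after \<open>z\<close> on the tree path from \<open>z\<close> to \<open>x\<close>. By exchanging edges
  this vertex is \<open>x\<close> or has degree 2 in the tree, and it is not adjacent to \<open>y\<close>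
  (\<open>parent_of_neighbour_of_leaf\<close>). It follows that the map is injective and that its image avoids the
  neighbours of \<open>y\<close>. As image and neighbourhood of \<open>y\<close> contain no leaf except possibly \<open>x\<close>, the bound
  follows by counting. This is the argument behind the classical Ore-type theorem of Broersma and
  Tuinstra on spanning \<open>k\<close>-ended trees.

  The degree condition on special subgraphs contradicts the bound: for three pairwise nonadjacent
  vertices \<open>x\<close>, \<open>y\<close>, \<open>w\<close> of a connected graph, \<open>x\<close> and \<open>y\<close> always lie together in a special
  induced subgraph (\<open>special_induced_subgraph\<close>). Three leaves of the tree are such vertices.

  Graphs are treated below as a finite vertex set \<open>V\<close> with a symmetric irreflexive relation, whose
  subrelations on the same vertex set represent the spanning subgraphs.
\<close>

section \<open>Breadth-first parents\<close>

definition connects :: "'a set \<Rightarrow> 'a rel \<Rightarrow> bool" where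
  "connects V E \<longleftrightarrow> (\<forall>u \<in> V. \<forall>v \<in> V. (u, v) \<in> E\<^sup>*)"

definition exchange :: "'a rel \<Rightarrow> 'a \<Rightarrow> 'a \<Rightarrow> 'a \<Rightarrow> 'a \<Rightarrow> 'a rel" where
  "exchange E a b x z = (E - {(a, b), (b, a)}) \<union> {(x, z), (z, x)}"

definition level :: "'a rel \<Rightarrow> 'a \<Rightarrow> 'a \<Rightarrow> nat" where
  "level E r v = (LEAST i. (r, v) \<in> E ^^ i)"

text \<open>
  Shortest paths stand in for the paths of a rooted tree, so the notion makes sense for any relation:
  an arbitrary neighbour of \<open>v\<close> one level closer to the root \<open>r\<close>. At the root the value is unspecified.
\<close>

definition parent :: "'a rel \<Rightarrow> 'a \<Rightarrow> 'a \<Rightarrow> 'a" where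
  "parent E r v = (SOME w. (w, v) \<in> E \<and> level E r v = Suc (level E r w))"

lemma level_root [simp]: "level E r r = 0"
  unfolding level_def by (rule Least_eq_0) simp

lemma level_step:
  assumes "(r, v) \<in> E\<^sup>*" and "(v, w) \<in> E"
  shows "level E r w \<le> Suc (level E r v)"
proof -
  have "\<exists>i. (r, v) \<in> E ^^ i"
    using assms(1) by (simp add: rtrancl_power)
  then have "(r, v) \<in> E ^^ level E r v"
    unfolding level_def by (rule LeastI_ex)
  then have "(r, w) \<in> E ^^ Suc (level E r v)"
    using assms(2) by auto
  then show ?thesis
    unfolding level_def [of E r w] by (rule Least_le)
qed

lemma parent:
  assumes "(r, v) \<in> E\<^sup>*" and "v \<noteq> r"
  shows "(parent E r v, v) \<in> E" and "level E r v = Suc (level E r (parent E r v))"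
proof -
  have "\<exists>i. (r, v) \<in> E ^^ i"
    using assms(1) by (simp add: rtrancl_power)
  then have *: "(r, v) \<in> E ^^ level E r v"
    unfolding level_def by (rule LeastI_ex)
  obtain m where m: "level E r v = Suc m"
    using * \<open>v \<noteq> r\<close> by (cases "level E r v") auto
  then obtain w where w: "(r, w) \<in> E ^^ m" "(w, v) \<in> E"
    using * by auto
  have "level E r w \<le> m"
    unfolding level_def using w(1) by (rule Least_le)
  moreover have "level E r v \<le> Suc (level E r w)"
    using w relpow_imp_rtrancl by (intro level_step) fastforce+
  ultimately have "(w, v) \<in> E \<and> level E r v = Suc (level E r w)"
    using w m by auto
  then have "(parent E r v, v) \<in> E \<and> level E r v = Suc (level E r (parent E r v))"
    unfolding parent_def by (rule someI)
  then show "(parent E r v, v) \<in> E" and "level E r v = Suc (level E r (parent E r v))"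
    by auto
qed

lemma closed_under_connecting:
  assumes "connects V E" and "r \<in> V" and "r \<in> S" and "E `` S \<subseteq> S"
  shows "V \<subseteq> S"
proof
  fix v
  assume "v \<in> V"
  then have "(r, v) \<in> E\<^sup>*"
    using assms by (simp add: connects_def)
  then show "v \<in> S"
    using assms(3,4) by (induction rule: rtrancl_induct) auto
qed

section \<open>Spanning trees and edge exchange\<close>

locale connected_graph =
  fixes V :: "'a set" and A :: "'a rel"
  assumes finite_V: "finite V"
    and A_subset: "A \<subseteq> V \<times> V"
    and sym_A: "sym A"
    and irrefl_A: "irrefl A"
    and connects_A: "connects V A"
begin

definition connector :: "'a rel \<Rightarrow> bool" where
  "connector E \<longleftrightarrow> E \<subseteq> A \<and> sym E \<and> connects V E"

text \<open>
  A connected spanning subgraph is a tree exactly when no other one has fewer edges. Taking this as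
  the definition makes an exchange of edges a matter of keeping connectedness and the number of
  arcs; the absence of cycles is needed only once, when the tree is finally delivered.
\<close>

definition sptree :: "'a rel \<Rightarrow> bool" where
  "sptree E \<longleftrightarrow> connector E \<and> (\<forall>F. connector F \<longrightarrow> card E \<le> card F)"

definition leaf_set :: "'a rel \<Rightarrow> 'a set" where
  "leaf_set E = {v \<in> V. card (E `` {v}) = 1}"

definition leaf_minimal :: "'a rel \<Rightarrow> bool" where
  "leaf_minimal E \<longleftrightarrow> sptree E \<and> (\<forall>F. sptree F \<longrightarrow> card (leaf_set E) \<le> card (leaf_set F))"

lemma adjacentD:
  assumes "(v, w) \<in> A"
  shows "v \<in> V" and "w \<in> V" and "v \<noteq> w" and "w \<noteq> v" and "(w, v) \<in> A"
  using assms A_subset irrefl_A sym_A by (auto simp: irrefl_def dest: symD)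

lemma finite_A: "finite A"
  using finite_V A_subset by (meson finite_SigmaI finite_subset)

lemma finite_leaf_set [simp]: "finite (leaf_set E)"
  using finite_V by (simp add: leaf_set_def)

lemma leaf_minimal_exists: "\<exists>E. leaf_minimal E"
proof -
  have "connector A"
    using sym_A connects_A by (simp add: connector_def)
  then obtain E where "sptree E"
    unfolding sptree_def using ex_has_least_nat [of connector A card] by auto
  then show ?thesis
    unfolding leaf_minimal_def
    using ex_has_least_nat [of sptree E "\<lambda>F. card (leaf_set F)"] by auto
qed

lemma sptreeD:
  assumes "sptree E"
  shows "E \<subseteq> A" and "sym E" and "connects V E" and "finite E"
    and "\<And>v. finite (E `` {v})" and "\<And>v w. (v, w) \<in> E \<Longrightarrow> (w, v) \<in> E"
    and "\<And>v w. (v, w) \<in> E \<Longrightarrow> v \<in> V \<and> w \<in> V \<and> v \<noteq> w"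
    and "\<And>v w. v \<in> V \<Longrightarrow> w \<in> V \<Longrightarrow> (v, w) \<in> E\<^sup>*"
proof -
  show 1: "E \<subseteq> A" and 2: "sym E" and 3: "connects V E"
    using assms by (auto simp: sptree_def connector_def)
  show 4: "finite E"
    using 1 finite_A finite_subset by auto
  show "finite (E `` {v})" for v
    using 4 by (simp add: finite_Image)
  show "(v, w) \<in> E \<Longrightarrow> (w, v) \<in> E" for v w
    using 2 by (auto dest: symD)
  show "(v, w) \<in> E \<Longrightarrow> v \<in> V \<and> w \<in> V \<and> v \<noteq> w" for v w
    using 1 adjacentD [of v w] by blast
  show "v \<in> V \<Longrightarrow> w \<in> V \<Longrightarrow> (v, w) \<in> E\<^sup>*" for v w
    using 3 by (simp add: connects_def)
qed

text \<open>
  Iterating \<^const>\<open>parent\<close> from \<open>z\<close> walks along a shortest path to the root, losing one level at each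
  step. In particular its vertices are distinct.
\<close>

lemma chain_to_root:
  assumes "sptree E" and "r \<in> V" and "z \<in> V" and "i \<le> level E r z"
  shows "(parent E r ^^ i) z \<in> V" and "level E r ((parent E r ^^ i) z) = level E r z - i"
proof -
  have "(parent E r ^^ i) z \<in> V \<and> level E r ((parent E r ^^ i) z) = level E r z - i"
    using assms(4)
  proof (induction i)
    case 0
    then show ?case using assms by simp
  next
    case (Suc i)
    let ?c = "(parent E r ^^ i) z"
    have c: "?c \<in> V" "level E r ?c = level E r z - i"
      using Suc by auto
    then have "?c \<noteq> r"
      using Suc.prems by (metis Suc_le_lessD level_root zero_less_diff less_irrefl)
    then have "(parent E r ?c, ?c) \<in> E" "level E r ?c = Suc (level E r (parent E r ?c))"
      using parent sptreeD(8) [OF assms(1)] c(1) assms(2) by metis+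
    then show ?case
      using c sptreeD(7) [OF assms(1)] by auto
  qed
  then show "(parent E r ^^ i) z \<in> V" and "level E r ((parent E r ^^ i) z) = level E r z - i"
    by auto
qed

lemma chain_edge:
  assumes "sptree E" and "r \<in> V" and "z \<in> V" and "i < level E r z"
  shows "((parent E r ^^ Suc i) z, (parent E r ^^ i) z) \<in> E"
proof -
  let ?c = "(parent E r ^^ i) z"
  have c: "?c \<in> V" "level E r ?c = level E r z - i"
    using chain_to_root [of E r z i] assms by auto
  then have "?c \<noteq> r"
    using assms(4) by auto
  then show ?thesis
    using parent(1) [of r ?c E] sptreeD(8) [OF assms(1,2) c(1)] by simp
qed

lemma level_0_root:
  assumes "sptree E" and "r \<in> V" and "v \<in> V" and "level E r v = 0"
  shows "v = r"
  using parent(2) [of r v E] sptreeD(8) [OF assms(1-3)] assms(4) by auto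

text \<open>
  Adding the edge \<open>rz\<close> closes a cycle with the chain of parents from \<open>z\<close> to \<open>r\<close>, and any edge of that
  chain may be deleted in return. Without the edge from \<open>c\<close> to its parent, the part of the chain from
  \<open>z\<close> to \<open>c\<close> lives on levels at least that of \<open>c\<close>, and the part from the parent of \<open>c\<close> to \<open>r\<close> on lower
  levels, so both survive; with \<open>rz\<close> they bypass the deleted edge.
\<close>

lemma sptree_exchange:
  assumes E: "sptree E" and "r \<in> V" and rz: "(r, z) \<in> A" "(r, z) \<notin> E"
    and i: "i < level E r z"
  defines "c \<equiv> (parent E r ^^ i) z"
  shows "sptree (exchange E c (parent E r c) r z)"
proof -
  let ?p = "parent E r" and ?l = "level E r"
  let ?F = "exchange E c (?p c) r z"
  note E' = sptreeD [OF E]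
  have z: "z \<in> V" "r \<noteq> z"
    using adjacentD [OF rz(1)] by auto
  have par: "(?p v, v) \<in> E" "(v, ?p v) \<in> E" "?p v \<in> V" "?l v = Suc (?l (?p v))"
    if "v \<in> V" "v \<noteq> r" for v
    using parent [of r v E] E'(6,7,8) that \<open>r \<in> V\<close> by metis+
  have chain: "(?p ^^ j) z \<in> V" "?l ((?p ^^ j) z) = ?l z - j" if "j \<le> ?l z" for j
    using chain_to_root [OF E \<open>r \<in> V\<close> z(1) that] by auto
  have c: "c \<in> V" "?l c = ?l z - i" "c \<noteq> r"
    using chain [of i] i unfolding c_def by auto
  have symF: "sym ?F"
    using E'(2) unfolding exchange_def sym_def by auto
  then have symF': "(w, v) \<in> ?F\<^sup>*" if "(v, w) \<in> ?F\<^sup>*" for v w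
    using that by (metis symD sym_rtrancl)
  \<comment> \<open>Parents of vertices below the level of \<open>c\<close> lead to the root without using the deleted edge.\<close>
  have down: "(w, r) \<in> ?F\<^sup>*" if "w \<in> V" "?l w < ?l c" for w
    using that
  proof (induction "?l w" arbitrary: w)
    case 0
    then show ?case
      using level_0_root [OF E \<open>r \<in> V\<close>] by auto
  next
    case (Suc m)
    then have "w \<noteq> r" by auto
    note p = par [OF \<open>w \<in> V\<close> this]
    have "(w, ?p w) \<in> ?F"
      using p Suc.prems par(4) [OF c(1,3)] unfolding exchange_def by auto
    moreover have "(?p w, r) \<in> ?F\<^sup>*"
      using p Suc by auto
    ultimately show ?case by (rule converse_rtrancl_into_rtrancl)
  qed
  have up: "(z, (?p ^^ j) z) \<in> ?F\<^sup>*" if "j \<le> i" for j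
    using that
  proof (induction j)
    case 0
    then show ?case by simp
  next
    case (Suc j)
    let ?w = "(?p ^^ j) z"
    have w: "?w \<in> V" "?l ?w = ?l z - j"
      using chain [of j] Suc.prems i by auto
    then have "?w \<noteq> r" using Suc.prems i by auto
    note p = par [OF w(1) this]
    have "(?w, ?p ?w) \<in> ?F"
      using p w c(2) Suc.prems i par(4) [OF c(1,3)] unfolding exchange_def by auto
    then show ?case
      using Suc by auto
  qed
  have "(?p c, r) \<in> ?F\<^sup>*"
    using down [of "?p c"] par [OF c(1,3)] by auto
  moreover have "(r, z) \<in> ?F\<^sup>*"
    by (auto simp: exchange_def)
  moreover have "(z, c) \<in> ?F\<^sup>*"
    using up [of i] by (simp add: c_def)
  ultimately have bridge: "(?p c, c) \<in> ?F\<^sup>*" "(c, ?p c) \<in> ?F\<^sup>*"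
    using symF' by (meson rtrancl_trans)+
  have "E \<subseteq> ?F\<^sup>*"
    using bridge by (auto simp: exchange_def)
  then have "E\<^sup>* \<subseteq> ?F\<^sup>*"
    by (rule rtrancl_subset_rtrancl)
  then have "connects V ?F"
    using E'(3) by (auto simp: connects_def)
  moreover have "?F \<subseteq> A"
    using E'(1) rz sym_A by (auto simp: exchange_def dest: symD)
  ultimately have "connector ?F"
    using symF by (simp add: connector_def)
  moreover have "card ?F = card E"
  proof -
    have "{(c, ?p c), (?p c, c)} \<subseteq> E" "c \<noteq> ?p c"
      using par [OF c(1,3)] E'(7) by auto
    then have "card (E - {(c, ?p c), (?p c, c)}) = card E - 2" "card E \<ge> 2"
      using E'(4) card_Diff_subset [of "{(c, ?p c), (?p c, c)}" E]
        card_mono [of E "{(c, ?p c), (?p c, c)}"] by auto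
    moreover have "(z, r) \<notin> E"
      using rz(2) E'(6) by auto
    ultimately show ?thesis
      unfolding exchange_def using rz(2) z(2) E'(4) by (simp add: card_insert_if)
  qed
  ultimately show ?thesis
    using E by (simp add: sptree_def)
qed

lemma inner_chain_vertex:
  assumes E: "sptree E" and "r \<in> V" and "z \<in> V" and i: "0 < i" "i < level E r z"
  defines "c \<equiv> \<lambda>j. (parent E r ^^ j) z"
  shows "{c (i - 1), c (i + 1)} \<subseteq> E `` {c i}" and "c (i - 1) \<noteq> c (i + 1)"
proof -
  have chain: "c j \<in> V" "level E r (c j) = level E r z - j" if "j \<le> level E r z" for j
    using chain_to_root [OF E \<open>r \<in> V\<close> \<open>z \<in> V\<close> that] by (auto simp: c_def)
  have edge: "(c (Suc j), c j) \<in> E" if "j < level E r z" for j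
    using chain_edge [OF E \<open>r \<in> V\<close> \<open>z \<in> V\<close> that] by (simp add: c_def)
  show "{c (i - 1), c (i + 1)} \<subseteq> E `` {c i}"
    using edge [of i] edge [of "i - 1"] i sptreeD(6) [OF E] by auto
  show "c (i - 1) \<noteq> c (i + 1)"
  proof -
    have "level E r (c (i - 1)) = level E r z - (i - 1)"
      using chain(2) [of "i - 1"] i by linarith
    moreover have "level E r (c (i + 1)) = level E r z - (i + 1)"
      using chain(2) [of "i + 1"] i by linarith
    ultimately show ?thesis using i by auto
  qed
qed

text \<open>
  If all inner vertices of the chain joining two leaves had degree 2, nothing could leave the chain;
  it would be the whole tree, which then has only two leaves.
\<close>

lemma branch_between_leaves:
  assumes E: "sptree E" and three: "card (leaf_set E) \<ge> 3"
    and u: "u \<in> leaf_set E" and v: "v \<in> leaf_set E" and "u \<noteq> v"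
  obtains i where "0 < i" and "i < level E u v" and "card (E `` {(parent E u ^^ i) v}) \<ge> 3"
proof -
  define c where "c j = (parent E u ^^ j) v" for j
  let ?d = "level E u v"
  note E' = sptreeD [OF E]
  have V: "u \<in> V" "v \<in> V"
    using u v by (auto simp: leaf_set_def)
  have chain: "c j \<in> V" "level E u (c j) = ?d - j" if "j \<le> ?d" for j
    using chain_to_root [OF E V that] by (auto simp: c_def)
  have "?d > 0"
    using level_0_root [OF E V] \<open>u \<noteq> v\<close> by auto
  have c0: "c 0 = v" by (simp add: c_def)
  have cd: "c ?d = u"
    using chain [of ?d] level_0_root [OF E V(1)] by auto
  have edge: "(c (Suc j), c j) \<in> E" if "j < ?d" for j
    using chain_edge [OF E V that] by (simp add: c_def)
  have leaf_nb: "E `` {w} = {q}" if "w \<in> leaf_set E" "(w, q) \<in> E" for w q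
  proof -
    obtain q' where "E `` {w} = {q'}"
      using \<open>w \<in> leaf_set E\<close> by (auto simp: leaf_set_def card_1_singleton_iff)
    moreover have "q \<in> E `` {w}" using that(2) by simp
    ultimately show ?thesis by simp
  qed
  have inner: "{c (i - 1), c (i + 1)} \<subseteq> E `` {c i}" "c (i - 1) \<noteq> c (i + 1)"
    if "0 < i" "i < ?d" for i
    using inner_chain_vertex [OF E V that] by (auto simp: c_def)
  have "\<exists>i. 0 < i \<and> i < ?d \<and> card (E `` {c i}) \<ge> 3"
  proof (rule ccontr)
    assume none: "\<not> ?thesis"
    let ?S = "c ` {..?d}"
    have "E `` {c i} \<subseteq> ?S" if i: "i \<le> ?d" for i
    proof -
      consider "i = 0" | "i = ?d" | "0 < i" "i < ?d"
        using i by linarith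
      then show ?thesis
      proof cases
        case 1
        then show ?thesis
          using leaf_nb [OF v, of "c 1"] edge [of 0] \<open>?d > 0\<close> E'(6) c0 by auto
      next
        case 2
        then show ?thesis
          using leaf_nb [OF u, of "c (?d - 1)"] edge [of "?d - 1"] \<open>?d > 0\<close> cd by auto
      next
        case 3
        then have "card (E `` {c i}) \<le> card {c (i - 1), c (i + 1)}"
          using none inner(2) [OF 3] by (auto simp: not_le)
        then have "{c (i - 1), c (i + 1)} = E `` {c i}"
          using inner(1) [OF 3] E'(5) by (intro card_seteq) auto
        moreover have "{c (i - 1), c (i + 1)} \<subseteq> ?S"
          using 3 by auto
        ultimately show ?thesis by simp
      qed
    qed
    then have "E `` ?S \<subseteq> ?S" by auto
    moreover have "v \<in> ?S" using c0 by force
    ultimately have "V \<subseteq> ?S"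
      using closed_under_connecting [OF E'(3) V(2)] by auto
    have "leaf_set E \<subseteq> {u, v}"
    proof
      fix w
      assume w: "w \<in> leaf_set E"
      then obtain i where i: "i \<le> ?d" "w = c i"
        using \<open>V \<subseteq> ?S\<close> by (auto simp: leaf_set_def)
      have "\<not> (0 < i \<and> i < ?d)"
      proof
        assume "0 < i \<and> i < ?d"
        then have "0 < i" "i < ?d" by auto
        then have "card {c (i - 1), c (i + 1)} \<le> card (E `` {c i})"
          using inner(1) [OF \<open>0 < i\<close> \<open>i < ?d\<close>] by (intro card_mono [OF E'(5)])
        then have "2 \<le> card (E `` {c i})"
          using inner(2) [OF \<open>0 < i\<close> \<open>i < ?d\<close>] by simp
        then show False
          using w i(2) by (simp add: leaf_set_def)
      qed
      then have "i = 0 \<or> i = ?d"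
        using i(1) by linarith
      then have "w = v \<or> w = u"
        using i(2) c0 cd by metis
      then show "w \<in> {u, v}" by auto
    qed
    then have "card (leaf_set E) \<le> card {u, v}"
      by (intro card_mono) auto
    then show False
      using three \<open>u \<noteq> v\<close> by simp
  qed
  then show thesis
    using that unfolding c_def by auto
qed

section \<open>Leaf-minimal trees\<close>

text \<open>
  If \<open>uv\<close> is an edge of the graph, add it to the tree and delete a chain edge \<open>ab\<close> at a vertex \<open>b\<close> of
  degree at least 3. The leaves \<open>u\<close> and \<open>v\<close> are lost, and only \<open>a\<close> can become a new leaf.
\<close>

lemma leaves_nonadjacent:
  assumes min: "leaf_minimal E" and three: "card (leaf_set E) \<ge> 3"
    and u: "u \<in> leaf_set E" and v: "v \<in> leaf_set E" and "u \<noteq> v"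
  shows "(u, v) \<notin> A"
proof
  assume uv: "(u, v) \<in> A"
  have E: "sptree E"
    using min by (simp add: leaf_minimal_def)
  note E' = sptreeD [OF E]
  have V: "u \<in> V" "v \<in> V"
    using u v by (auto simp: leaf_set_def)
  obtain i where i: "0 < i" "i < level E u v" and b3: "card (E `` {(parent E u ^^ i) v}) \<ge> 3"
    using branch_between_leaves [OF E three u v \<open>u \<noteq> v\<close>] .
  define a where "a = (parent E u ^^ (i - 1)) v"
  define b where "b = (parent E u ^^ i) v"
  have b: "b = parent E u a"
    using i by (cases i) (auto simp: a_def b_def)
  have "(u, v) \<notin> E"
    using level_step [of u u E v] i by auto
  then have F: "sptree (exchange E a b u v)" (is "sptree ?F")
    using sptree_exchange [OF E V(1) uv, of "i - 1"] i by (simp add: a_def b)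
  note F' = sptreeD [OF F]
  have b_uv: "b \<noteq> u" "b \<noteq> v"
    using u v b3 by (auto simp: leaf_set_def b_def)
  have "(v, u) \<notin> E"
    using \<open>(u, v) \<notin> E\<close> E'(6) by auto
  \<comment> \<open>A leaf keeps its own tree edge besides \<open>uv\<close>, unless that is the deleted edge \<open>ab\<close>.\<close>
  have leaf: "w = a" if w: "w \<in> {u, v}" "w \<in> leaf_set ?F" for w
  proof (rule ccontr)
    assume "w \<noteq> a"
    have "w \<in> leaf_set E" using w u v by auto
    then obtain q where q: "(w, q) \<in> E"
      by (auto simp: leaf_set_def card_1_singleton_iff)
    obtain w' where w': "{w, w'} = {u, v}"
      using w by auto
    have "w \<noteq> b" using w b_uv by auto
    then have "{q, w'} \<subseteq> ?F `` {w}"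
      using q w' \<open>w \<noteq> a\<close> by (auto simp: exchange_def doubleton_eq_iff)
    moreover have "q \<noteq> w'"
      using q w' \<open>(u, v) \<notin> E\<close> \<open>(v, u) \<notin> E\<close> by (auto simp: doubleton_eq_iff)
    ultimately have "card (?F `` {w}) \<ge> 2"
      using card_mono [OF F'(5), of "{q, w'}" w] by simp
    then show False using w by (simp add: leaf_set_def)
  qed
  have "b \<notin> leaf_set ?F"
  proof -
    have "E `` {b} - {a} \<subseteq> ?F `` {b}"
      by (auto simp: exchange_def)
    then have "card (E `` {b} - {a}) \<le> card (?F `` {b})"
      using card_mono [OF F'(5)] by blast
    moreover have "card (E `` {b} - {a}) \<ge> card (E `` {b}) - 1"
      using diff_card_le_card_Diff [of "{a}" "E `` {b}"] by simp
    moreover have "card (E `` {b}) \<ge> 3"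
      using b3 by (simp add: b_def)
    ultimately have "card (?F `` {b}) \<ge> 2" by linarith
    then show ?thesis by (simp add: leaf_set_def)
  qed
  have "leaf_set ?F \<subseteq> insert a (leaf_set E - {u, v})"
  proof
    fix w
    assume w: "w \<in> leaf_set ?F"
    show "w \<in> insert a (leaf_set E - {u, v})"
    proof (cases "w \<in> {a, b, u, v}")
      case True
      then show ?thesis
        using w leaf \<open>b \<notin> leaf_set ?F\<close> by auto
    next
      case False
      then have "?F `` {w} = E `` {w}"
        by (auto simp: exchange_def)
      then show ?thesis
        using w False by (auto simp: leaf_set_def)
    qed
  qed
  then have "card (leaf_set ?F) \<le> card (insert a (leaf_set E - {u, v}))"
    by (intro card_mono) auto
  also have "\<dots> \<le> Suc (card (leaf_set E - {u, v}))"
    by (rule card_insert_le_m1) auto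
  also have "\<dots> = card (leaf_set E) - 1"
    using u v \<open>u \<noteq> v\<close> three by (simp add: card_Diff_subset)
  finally have "card (leaf_set ?F) < card (leaf_set E)"
    using three by linarith
  then show False
    using min F by (auto simp: leaf_minimal_def not_le)
qed

text \<open>
  The vertex \<open>b\<close> that follows \<open>z\<close> on its way to \<open>x\<close> is the one that \<open>y\<close> has to miss for every neighbour
  \<open>z\<close> of \<open>x\<close>. Replacing the edge \<open>zb\<close> by \<open>xz\<close> destroys the leaf \<open>x\<close>, so by minimality it must create
  the leaf \<open>b\<close>, that is, \<open>b\<close> has degree 2. The new tree is then leaf-minimal as well, and its leaves \<open>b\<close>
  and \<open>y\<close> cannot be adjacent.
\<close>

lemma parent_of_neighbour_of_leaf:
  assumes min: "leaf_minimal E" and three: "card (leaf_set E) \<ge> 3"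
    and x: "x \<in> leaf_set E" and y: "y \<in> leaf_set E" and "x \<noteq> y" and xz: "(x, z) \<in> A"
  shows "(y, parent E x z) \<notin> A"
    and "parent E x z \<noteq> x \<Longrightarrow> card (E `` {parent E x z}) = 2"
proof -
  define b where "b = parent E x z"
  have E: "sptree E"
    using min by (simp add: leaf_minimal_def)
  note E' = sptreeD [OF E]
  have V: "x \<in> V" "y \<in> V" "z \<in> V" and "z \<noteq> x"
    using x y adjacentD [OF xz] by (auto simp: leaf_set_def)
  have par: "(b, z) \<in> E" "level E x z = Suc (level E x b)"
    using parent [of x z E] E'(8) V \<open>z \<noteq> x\<close> by (auto simp: b_def)
  have "b \<in> V" "b \<noteq> z"
    using par E'(7) by auto
  have "z \<noteq> y"
    using leaves_nonadjacent [OF min three x y \<open>x \<noteq> y\<close>] xz by auto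
  have "(y, b) \<notin> A \<and> (b \<noteq> x \<longrightarrow> card (E `` {b}) = 2)"
  proof (cases "b = x")
    case True
    then show ?thesis
      using leaves_nonadjacent [OF min three y x] \<open>x \<noteq> y\<close> by auto
  next
    case False
    let ?p = "parent E x b"
    have p: "(?p, b) \<in> E" "level E x b = Suc (level E x ?p)"
      using parent [of x b E] E'(8) V \<open>b \<in> V\<close> False by auto
    have "(x, z) \<notin> E"
      using level_step [of x x E z] par p by auto
    then have F: "sptree (exchange E z b x z)" (is "sptree ?F")
      using sptree_exchange [OF E V(1) xz, of 0] par by (simp add: b_def)
    note F' = sptreeD [OF F]
    have "{z, ?p} \<subseteq> E `` {b}" "z \<noteq> ?p"
      using par p E'(6) by auto
    then have b2: "card (E `` {b}) \<ge> 2"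
      using card_mono [OF E'(5), of "{z, ?p}" b] by auto
    have Fb: "?F `` {b} = E `` {b} - {z}"
      using False \<open>b \<noteq> z\<close> by (auto simp: exchange_def)
    have card_Fb: "card (?F `` {b}) = card (E `` {b}) - 1"
      unfolding Fb using par E'(6) by (intro card_Diff_singleton) auto
    have "?F `` {z} = insert x (E `` {z} - {b})"
      using \<open>z \<noteq> x\<close> \<open>b \<noteq> z\<close> by (auto simp: exchange_def)
    moreover have "card (insert x (E `` {z} - {b})) = card (E `` {z})"
    proof -
      have "x \<notin> E `` {z} - {b}"
        using \<open>(x, z) \<notin> E\<close> E'(6) by auto
      moreover have "b \<in> E `` {z}"
        using par E'(6) by auto
      ultimately show ?thesis
        using E'(5) card_insert_disjoint card_Suc_Diff1 by (metis finite_Diff)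
    qed
    ultimately have card_Fz: "card (?F `` {z}) = card (E `` {z})"
      by simp
    have "x \<notin> leaf_set ?F"
    proof -
      obtain q where q: "(x, q) \<in> E"
        using x by (auto simp: leaf_set_def card_1_singleton_iff)
      have "{q, z} \<subseteq> ?F `` {x}" "q \<noteq> z"
        using q \<open>z \<noteq> x\<close> False \<open>(x, z) \<notin> E\<close> by (auto simp: exchange_def)
      then have "card (?F `` {x}) \<ge> 2"
        using card_mono [OF F'(5), of "{q, z}" x] by auto
      then show ?thesis by (simp add: leaf_set_def)
    qed
    have others: "?F `` {w} = E `` {w}" if "w \<notin> {x, z, b}" for w
      using that by (auto simp: exchange_def)
    have leaf_set_F: "leaf_set ?F \<subseteq> leaf_set E - {x} \<union> (if card (E `` {b}) = 2 then {b} else {})"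
    proof
      fix w
      assume w: "w \<in> leaf_set ?F"
      consider "w = x" | "w = z" | "w = b" | "w \<notin> {x, z, b}" by blast
      then show "w \<in> leaf_set E - {x} \<union> (if card (E `` {b}) = 2 then {b} else {})"
        using w \<open>x \<notin> leaf_set ?F\<close> \<open>z \<noteq> x\<close> card_Fz card_Fb b2 others
        by cases (auto simp: leaf_set_def)
    qed
    have F_min: "card (leaf_set E) \<le> card (leaf_set ?F)"
      using min F by (simp add: leaf_minimal_def)
    have card_x: "card (leaf_set E - {x}) = card (leaf_set E) - 1"
      using x by simp
    have deg2: "card (E `` {b}) = 2"
    proof (rule ccontr)
      assume "card (E `` {b}) \<noteq> 2"
      then have "card (leaf_set ?F) \<le> card (leaf_set E - {x})"
        using leaf_set_F by (intro card_mono) auto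
      then show False
        using F_min card_x three by linarith
    qed
    have "card (leaf_set ?F) \<le> card (insert b (leaf_set E - {x}))"
      using leaf_set_F deg2 by (intro card_mono) auto
    also have "\<dots> \<le> Suc (card (leaf_set E - {x}))"
      by (rule card_insert_le_m1) auto
    also have "\<dots> = card (leaf_set E)"
      using card_x three by simp
    finally have "leaf_minimal ?F"
      using min F by (auto simp: leaf_minimal_def intro: le_trans)
    moreover have "card (leaf_set ?F) \<ge> 3"
      using F_min three by simp
    moreover have "b \<in> leaf_set ?F"
      using card_Fb deg2 \<open>b \<in> V\<close> by (simp add: leaf_set_def)
    moreover have "b \<noteq> y"
      using deg2 y by (auto simp: leaf_set_def)
    moreover have "y \<in> leaf_set ?F"
      using y others [of y] \<open>x \<noteq> y\<close> \<open>z \<noteq> y\<close> \<open>b \<noteq> y\<close> by (auto simp: leaf_set_def)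
    ultimately have "(y, b) \<notin> A"
      using leaves_nonadjacent by auto
    then show ?thesis using deg2 by simp
  qed
  then show "(y, parent E x z) \<notin> A"
    and "parent E x z \<noteq> x \<Longrightarrow> card (E `` {parent E x z}) = 2"
    by (auto simp: b_def)
qed

text \<open>
  A common parent of two neighbours of \<open>x\<close> would have degree at least 3, counting the edge to its own
  parent, unless it is \<open>x\<close>; and the leaf \<open>x\<close> is the parent of only one vertex.
\<close>

lemma parent_inj_on_neighbours_of_leaf:
  assumes min: "leaf_minimal E" and three: "card (leaf_set E) \<ge> 3" and x: "x \<in> leaf_set E"
  shows "inj_on (parent E x) (A `` {x})"
proof (rule inj_onI)
  fix z z'
  assume z: "z \<in> A `` {x}" and z': "z' \<in> A `` {x}" and eq: "parent E x z = parent E x z'"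
  define b where "b = parent E x z"
  have E: "sptree E"
    using min by (simp add: leaf_minimal_def)
  note E' = sptreeD [OF E]
  have V: "x \<in> V" "z \<in> V" "z' \<in> V" "z \<noteq> x" "z' \<noteq> x"
    using adjacentD [of x z] adjacentD [of x z'] z z' by simp_all
  have "leaf_set E \<noteq> {x}"
    using three by auto
  then obtain y where y: "y \<in> leaf_set E" "x \<noteq> y"
    using x by auto
  have par: "z \<in> E `` {b}" "z' \<in> E `` {b}"
      "level E x z = Suc (level E x b)" "level E x z' = Suc (level E x b)"
    using parent [of x z E] parent [of x z' E] E'(8) V eq by (auto simp: b_def)
  show "z = z'"
  proof (cases "b = x")
    case True
    obtain q where "E `` {x} = {q}"
      using x by (auto simp: leaf_set_def card_1_singleton_iff)
    then show ?thesis
      using par(1,2) True by simp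
  next
    case False
    have "b \<in> V"
      using par E'(7) by auto
    let ?p = "parent E x b"
    have p: "?p \<in> E `` {b}" "level E x b = Suc (level E x ?p)"
      using parent [of x b E] E'(6,8) V \<open>b \<in> V\<close> False by auto
    have "card (E `` {b}) = 2"
      using parent_of_neighbour_of_leaf(2) [OF min three x y(1,2)] z False by (auto simp: b_def)
    then have "card {z, z', ?p} \<le> 2"
      using card_mono [OF E'(5), of "{z, z', ?p}" b] par p by auto
    moreover have "?p \<noteq> z" "?p \<noteq> z'"
      using par p by auto
    ultimately show ?thesis
      by (auto simp: card_insert_if split: if_splits)
  qed
qed

text \<open>
  The parents \<open>P\<close> of the neighbours of \<open>x\<close> and the neighbours of \<open>y\<close> are disjoint sets, \<open>P\<close> is as large
  as the neighbourhood of \<open>x\<close>, and neither set contains a leaf other than \<open>x\<close>.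
\<close>

lemma leaf_degree_sum:
  assumes min: "leaf_minimal E" and three: "card (leaf_set E) \<ge> 3"
    and x: "x \<in> leaf_set E" and y: "y \<in> leaf_set E" and "x \<noteq> y"
  shows "card (A `` {x}) + card (A `` {y}) + card (leaf_set E) \<le> card V + 1"
proof -
  let ?P = "parent E x ` (A `` {x})" and ?L = "leaf_set E - {x}"
  have E: "sptree E"
    using min by (simp add: leaf_minimal_def)
  note E' = sptreeD [OF E]
  have L_V: "leaf_set E \<subseteq> V"
    by (auto simp: leaf_set_def)
  have finite_nb: "finite (A `` {v})" for v
    using finite_A by (simp add: finite_Image)
  have "parent E x z \<in> V - ?L" if "(x, z) \<in> A" for z
  proof -
    have "z \<in> V" "z \<noteq> x"
      using adjacentD [OF that] by auto
    then have "parent E x z \<in> V"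
      using parent(1) [of x z E] E'(7,8) x by (auto simp: leaf_set_def)
    then show ?thesis
      using parent_of_neighbour_of_leaf(2) [OF min three x y \<open>x \<noteq> y\<close> that]
      by (cases "parent E x z = x") (auto simp: leaf_set_def)
  qed
  then have "?P \<subseteq> V - ?L" by auto
  moreover have "A `` {y} \<subseteq> V - ?L"
    using adjacentD leaves_nonadjacent [OF min three y] by (metis DiffD1 DiffI Diff_iff Image_singleton_iff subsetI)
  ultimately have "card (?P \<union> A `` {y}) \<le> card (V - ?L)"
    using finite_V by (intro card_mono) auto
  moreover have "?P \<inter> A `` {y} = {}"
    using parent_of_neighbour_of_leaf(1) [OF min three x y \<open>x \<noteq> y\<close>] by auto
  then have "card (?P \<union> A `` {y}) = card ?P + card (A `` {y})"
    using finite_nb by (intro card_Un_disjoint) auto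
  moreover have "card ?P = card (A `` {x})"
    using parent_inj_on_neighbours_of_leaf [OF min three x] by (rule card_image)
  moreover have "card (V - ?L) = card V - card ?L"
    using L_V by (intro card_Diff_subset) auto
  moreover have "card ?L = card (leaf_set E) - 1"
    using x by simp
  moreover have "card (leaf_set E) \<le> card V"
    using L_V finite_V by (rule card_mono [rotated])
  ultimately show ?thesis
    using three by linarith
qed

section \<open>Leaf-minimal trees as undirected trees\<close>

lemma pcas_rtrancl:
  assumes "pcas s q u" and "set q \<subseteq> E" and "set (pawalk_verts s q) \<subseteq> S"
  shows "(s, u) \<in> (E \<inter> S \<times> S)\<^sup>*" and "u \<in> S"
proof -
  have "(s, u) \<in> (E \<inter> S \<times> S)\<^sup>* \<and> u \<in> S"
    using assms
  proof (induction q arbitrary: s)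
    case Nil
    then show ?case by simp
  next
    case (Cons e q)
    obtain t where e: "e = (s, t)"
      using Cons.prems(1) by (cases e) auto
    have "t \<in> set (pawalk_verts t q)"
      using Cons.prems(1) e by (cases q) auto
    then have "(s, t) \<in> E \<inter> S \<times> S"
      using Cons.prems e by auto
    moreover have "(t, u) \<in> (E \<inter> S \<times> S)\<^sup>* \<and> u \<in> S"
      using Cons e by auto
    ultimately show ?case
      by (meson converse_rtrancl_into_rtrancl)
  qed
  then show "(s, u) \<in> (E \<inter> S \<times> S)\<^sup>*" and "u \<in> S"
    by auto
qed

text \<open>
  On a cycle of length at least 3 the first edge \<open>uv\<close> is bypassed by the rest of the cycle, so deleting
  it would leave a smaller connected spanning subgraph.
\<close>

lemma sptree_no_long_cycle:
  assumes E: "sptree E" and cycle: "pre_digraph.cycle (with_proj \<lparr>pverts = V, parcs = E\<rparr>) p"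
  shows "length p < 3"
proof (rule ccontr)
  assume "\<not> length p < 3"
  then obtain e e' e'' q where p: "p = e # e' # e'' # q"
    by (auto simp: numeral_3_eq_3 not_less Suc_le_length_iff)
  obtain u where u: "pcas u p u" "set p \<subseteq> E" "distinct (tl (pawalk_verts u p))"
    using cycle
    by (auto simp: pre_digraph.cycle_def pre_digraph.awalk_def cas_with_proj_eq
        awalk_verts_with_proj_eq)
  obtain v w s where arcs: "e = (u, v)" "e' = (v, w)" "e'' = (w, s)"
    using u(1) unfolding p by (cases e, cases e', cases e'') auto
  have "pcas w (e'' # q) u" "set (e'' # q) \<subseteq> E" "set (pawalk_verts w (e'' # q)) \<subseteq> - {v}"
    using u unfolding p arcs by auto
  note rest = pcas_rtrancl [OF this]
  have "w \<noteq> u"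
    using pcas_rtrancl(2) [of s q u E "- {w}"] u unfolding p arcs by auto
  let ?F = "E - {(u, v), (v, u)}"
  have "(w, u) \<in> ?F\<^sup>*"
    using rest(1) rtrancl_mono [of "E \<inter> (- {v}) \<times> (- {v})" ?F] by auto
  moreover have "(v, w) \<in> ?F"
    using u(2) sptreeD(7) [OF E] \<open>w \<noteq> u\<close> unfolding p arcs by auto
  ultimately have vu: "(v, u) \<in> ?F\<^sup>*"
    by (rule converse_rtrancl_into_rtrancl [rotated])
  have symF: "sym ?F"
    using sptreeD(2) [OF E] unfolding sym_def by auto
  then have "(u, v) \<in> ?F\<^sup>*"
    using vu by (metis symD sym_rtrancl)
  then have "E \<subseteq> ?F\<^sup>*"
    using vu by auto
  then have "E\<^sup>* \<subseteq> ?F\<^sup>*"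
    by (rule rtrancl_subset_rtrancl)
  then have "connector ?F"
    using sptreeD(1,3) [OF E] symF by (auto simp: connector_def connects_def)
  moreover have "card ?F < card E"
    using u(2) sptreeD(4) [OF E] unfolding p arcs by (intro psubset_card_mono) auto
  ultimately show False
    using E by (auto simp: sptree_def)
qed

lemma sptree_undirected_tree:
  assumes E: "sptree E" and "V \<noteq> {}"
  shows "undirected_tree \<lparr>pverts = V, parcs = E\<rparr>" (is "undirected_tree ?T")
proof -
  note E' = sptreeD [OF E]
  have "pair_graph ?T"
    using E'(2,4,7) finite_V by unfold_locales (auto simp: symmetric_def)
  moreover have "mk_symmetric (with_proj ?T) = ?T"
    using E'(6) by (auto simp: mk_symmetric_def)
  then have "Digraph_Component.connected (with_proj ?T)"
    using E'(7,8) \<open>V \<noteq> {}\<close> rtrancl_consistent_rtrancl_on [of _ _ E V]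
    by (auto simp: Digraph_Component.connected_def strongly_connected_def reachable_def)
  ultimately show ?thesis
    using sptree_no_long_cycle [OF E] by (auto simp: undirected_tree_def not_le)
qed

end

lemma vertex_degree_eq: "vertex_degree T v = card (parcs T `` {v})"
proof -
  have "out_arcs (with_proj T) v = Pair v ` (parcs T `` {v})"
    by (auto simp: out_arcs_def)
  then show ?thesis
    unfolding vertex_degree_def out_degree_def by (simp add: card_image inj_on_def)
qed

lemma connected_graph_pair_graph:
  assumes "pair_graph G" and "Digraph_Component.connected (with_proj G)"
  shows "connected_graph (pverts G) (parcs G)" and "pverts G \<noteq> {}"
proof -
  interpret pair_graph G by fact
  have sym: "mk_symmetric (with_proj G) = \<lparr>pverts = pverts G, parcs = parcs G\<rparr>"
    using arcs_symmetric by (auto simp: mk_symmetric_def)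
  show "connected_graph (pverts G) (parcs G)"
  proof
    show "sym (parcs G)"
      using arcs_symmetric by (auto simp: sym_def)
    show "irrefl (parcs G)"
      using no_loops' by (auto simp: irrefl_def)
    show "connects (pverts G) (parcs G)"
      using assms(2) reachable_rtranclI
      by (fastforce simp: sym Digraph_Component.connected_def strongly_connected_def connects_def)
  qed (auto dest: in_arcsD1 in_arcsD2)
  show "pverts G \<noteq> {}"
    using assms(2) by (simp add: sym Digraph_Component.connected_def strongly_connected_def)
qed

section \<open>Induced subgraphs on four vertices\<close>

definition path3 :: "'a \<Rightarrow> 'a \<Rightarrow> 'a \<Rightarrow> 'a rel" where
  "path3 a b c = {(a, b), (b, a), (b, c), (c, b)}"

lemma special_graph_path3:
  assumes "distinct [a, b, c, d]"
  shows "special_graph \<lparr>pverts = {a, b, c, d}, parcs = path3 a b c\<rparr>" (is "special_graph ?W")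
    and "\<lbrakk>p \<in> {a, b, c, d}; q \<in> {a, b, c, d}; p \<noteq> q; (p, q) \<notin> path3 a b c\<rbrakk> \<Longrightarrow>
      special_graph \<lparr>pverts = {a, b, c, d}, parcs = path3 a b c \<union> {(p, q), (q, p)}\<rparr>"
proof -
  have refl: "digraph_iso (with_proj H) (with_proj H)" if "pair_wf_digraph H" for H :: "'a pair_pre_digraph"
  proof -
    let ?id = "\<lparr>iso_verts = id, iso_arcs = id, iso_head = snd, iso_tail = fst\<rparr>"
    have "pre_digraph.digraph_isomorphism (with_proj H) ?id"
      using that by (simp add: pre_digraph.digraph_isomorphism_def wf_digraph_wp_iff)
    moreover have "with_proj H = app_iso ?id (with_proj H)"
      by (simp add: app_iso_def with_proj_def)
    ultimately show ?thesis
      unfolding digraph_iso_def by blast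
  qed
  have "complete_bipartite_digraph 1 2 (with_proj \<lparr>pverts = {a, b, c}, parcs = path3 a b c\<rparr>)"
  proof -
    have "{a, b, c} = {b} \<union> {a, c}" "{b} \<inter> {a, c} = {}" "card {b} = 1" "card {a, c} = 2"
        "path3 a b c = {b} \<times> {a, c} \<union> {a, c} \<times> {b}"
      using assms by (auto simp: path3_def)
    then show ?thesis
      unfolding complete_bipartite_digraph_pair_def pair_pre_digraph.simps
      by (intro conjI exI) auto
  qed
  moreover have "complete_digraph 1 (with_proj \<lparr>pverts = {d}, parcs = {}\<rparr>)"
    unfolding complete_digraph_pair_def by auto
  ultimately have W: "K12_Un_K1 ?W"
    unfolding K12_Un_K1_def using assms
    by (intro exI [of _ "\<lparr>pverts = {a, b, c}, parcs = path3 a b c\<rparr>"]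
        exI [of _ "\<lparr>pverts = {d}, parcs = {}\<rparr>"]) auto
  have "pair_wf_digraph ?W"
    by unfold_locales (auto simp: path3_def)
  then show "special_graph ?W"
    using W refl unfolding special_graph_def by blast
  assume pq: "p \<in> {a, b, c, d}" "q \<in> {a, b, c, d}" "p \<noteq> q" "(p, q) \<notin> path3 a b c"
  let ?W' = "\<lparr>pverts = {a, b, c, d}, parcs = path3 a b c \<union> {(p, q), (q, p)}\<rparr>"
  have "is_plus_edge ?W ?W'"
    unfolding is_plus_edge_def using pq by (intro exI [of _ p] exI [of _ q]) simp
  moreover have "pair_wf_digraph ?W'"
    using pq(1,2) by unfold_locales (auto simp: path3_def)
  ultimately show "special_graph ?W'"
    using W refl unfolding special_graph_def by blast
qed

text \<open>
  A common neighbour \<open>b\<close> of \<open>x\<close> and \<open>y\<close> yields the path \<open>x b y\<close>, to which \<open>w\<close> can be attached at \<open>b\<close>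
  only: \<open>K\<^sub>1\<^sub>,\<^sub>2 \<union> K\<^sub>1\<close> or \<open>K\<^sub>1\<^sub>,\<^sub>3\<close>. Without a common neighbour, \<open>y\<close> is at distance at least 3 from
  \<open>x\<close>, so there is an induced path \<open>x u z\<close>, to which \<open>y\<close> can be attached at \<open>z\<close> only:
  \<open>K\<^sub>1\<^sub>,\<^sub>2 \<union> K\<^sub>1\<close> or a path on four vertices. Here \<open>w\<close> excludes graphs such as \<open>C\<^sub>4\<close>, in which \<open>x\<close> and \<open>y\<close>
  are both adjacent to everything else.
\<close>

lemma (in connected_graph) special_induced_subgraph:
  assumes V: "x \<in> V" "y \<in> V" "w \<in> V" and dist: "x \<noteq> y" "x \<noteq> w" "y \<noteq> w"
    and non: "(x, y) \<notin> A" "(x, w) \<notin> A" "(y, w) \<notin> A"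
  obtains S where "{x, y} \<subseteq> S" and "S \<subseteq> V" and "special_graph \<lparr>pverts = S, parcs = A \<inter> S \<times> S\<rparr>"
proof -
  have loop: "(v, v) \<notin> A" for v
    using irrefl_A by (simp add: irrefl_def)
  have sym: "(v, u) \<in> A \<longleftrightarrow> (u, v) \<in> A" for u v
    using sym_A by (auto dest: symD)
  show thesis
  proof (cases "\<exists>b. (x, b) \<in> A \<and> (y, b) \<in> A")
    case True
    then obtain b where b: "(x, b) \<in> A" "(y, b) \<in> A" by auto
    then have d: "distinct [x, b, y, w]"
      using dist non loop by auto
    let ?S = "{x, b, y, w}"
    have "special_graph \<lparr>pverts = ?S, parcs = A \<inter> ?S \<times> ?S\<rparr>"
    proof (cases "(b, w) \<in> A")
      case True
      then have "A \<inter> ?S \<times> ?S = path3 x b y \<union> {(b, w), (w, b)}"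
        using b non by (auto simp: path3_def loop sym)
      then show ?thesis
        using special_graph_path3(2) [OF d, of b w] d by (auto simp: path3_def)
    next
      case False
      then have "A \<inter> ?S \<times> ?S = path3 x b y"
        using b non by (auto simp: path3_def loop sym)
      then show ?thesis
        using special_graph_path3(1) [OF d] by simp
    qed
    moreover have "?S \<subseteq> V"
      using V adjacentD(2) [OF b(1)] by auto
    ultimately show thesis
      by (intro that [of ?S]) auto
  next
    case False
    \<comment> \<open>As \<open>y\<close> lies outside the closed neighbourhood of \<open>x\<close>, some edge \<open>uz\<close> leaves it.\<close>
    let ?N = "insert x (A `` {x})"
    have "y \<notin> ?N"
      using dist non by auto
    then have "\<not> A `` ?N \<subseteq> ?N"
      using closed_under_connecting [OF connects_A V(1), of ?N] V(2) by auto
    then obtain u z where u: "(x, u) \<in> A" and z: "(u, z) \<in> A" "z \<noteq> x" "(x, z) \<notin> A"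
      by auto
    have uy: "(u, y) \<notin> A"
      using False u sym by auto
    have d: "distinct [x, u, z, y]"
      using u z uy dist non loop by auto
    let ?S = "{x, u, z, y}"
    have "special_graph \<lparr>pverts = ?S, parcs = A \<inter> ?S \<times> ?S\<rparr>"
    proof (cases "(z, y) \<in> A")
      case True
      then have "A \<inter> ?S \<times> ?S = path3 x u z \<union> {(z, y), (y, z)}"
        using u z uy non by (auto simp: path3_def loop sym)
      then show ?thesis
        using special_graph_path3(2) [OF d, of z y] d by (auto simp: path3_def)
    next
      case False
      then have "A \<inter> ?S \<times> ?S = path3 x u z"
        using u z uy non by (auto simp: path3_def loop sym)
      then show ?thesis
        using special_graph_path3(1) [OF d] by simp
    qed
    moreover have "?S \<subseteq> V"
      using V adjacentD(2) u z by auto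
    ultimately show thesis
      by (intro that [of ?S]) auto
  qed
qed

section \<open>Spanning \<open>k\<close>-ended trees\<close>

theorem corollary2:
  fixes G :: "'a pair_pre_digraph" and k n :: nat
  assumes "k \<ge> 2"
    and "pair_graph G"
    and "Digraph_Component.connected (with_proj G)"
    and "n = card (pverts G)"
    and "\<And>H x y. induced_subgraph (with_proj H) (with_proj G) \<Longrightarrow> special_graph H \<Longrightarrow>
           x \<in> pverts H \<Longrightarrow> y \<in> pverts H \<Longrightarrow> x \<noteq> y \<Longrightarrow> (x, y) \<notin> parcs H \<Longrightarrow>
           int (vertex_degree G x) + int (vertex_degree G y) \<ge> int n - int k + 1"
  shows "\<exists>T. spanning_k_ended_tree k T G"
proof -
  interpret pair_graph G by fact
  interpret C: connected_graph "pverts G" "parcs G"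
    using assms(2,3) by (rule connected_graph_pair_graph)
  have "pverts G \<noteq> {}"
    using assms(2,3) by (rule connected_graph_pair_graph)
  obtain E where min: "C.leaf_minimal E"
    using C.leaf_minimal_exists by auto
  then have E: "C.sptree E"
    by (simp add: C.leaf_minimal_def)
  let ?T = "\<lparr>pverts = pverts G, parcs = E\<rparr>"
  have "card (C.leaf_set E) \<le> k"
  proof (rule ccontr)
    assume many: "\<not> card (C.leaf_set E) \<le> k"
    then have three: "card (C.leaf_set E) \<ge> 3"
      using \<open>k \<ge> 2\<close> by simp
    then obtain L where "L \<subseteq> C.leaf_set E" "card L = 3"
      by (meson obtain_subset_with_card_n)
    then obtain x y w where in_leaf_set: "x \<in> C.leaf_set E" "y \<in> C.leaf_set E" "w \<in> C.leaf_set E"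
        and dist: "x \<noteq> y" "x \<noteq> w" "y \<noteq> w"
      by (auto simp: card_3_iff)
    have non: "(x, y) \<notin> parcs G" "(x, w) \<notin> parcs G" "(y, w) \<notin> parcs G"
      using C.leaves_nonadjacent [OF min three] in_leaf_set dist by auto
    have V: "x \<in> pverts G" "y \<in> pverts G" "w \<in> pverts G"
      using in_leaf_set by (auto simp: C.leaf_set_def)
    obtain S where S: "{x, y} \<subseteq> S" "S \<subseteq> pverts G"
        "special_graph \<lparr>pverts = S, parcs = parcs G \<inter> S \<times> S\<rparr>" (is "special_graph ?H")
      using C.special_induced_subgraph [OF V dist non] .
    have "wf_digraph (with_proj ?H)"
      unfolding wf_digraph_wp_iff by unfold_locales auto
    then have "induced_subgraph (with_proj ?H) (with_proj G)"
      using S(2) wf_digraph by (auto simp: induced_subgraph_def subgraph_def compatible_def)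
    then have "int (vertex_degree G x) + int (vertex_degree G y) \<ge> int n - int k + 1"
      using assms(5) [of ?H x y] S(1,3) dist(1) non(1) by simp
    moreover have "vertex_degree G x + vertex_degree G y + card (C.leaf_set E) \<le> n + 1"
      using C.leaf_degree_sum [OF min three in_leaf_set(1,2) dist(1)] assms(4)
      by (simp add: vertex_degree_eq)
    ultimately show False
      using many by linarith
  qed
  moreover have "leaves ?T = C.leaf_set E"
    by (simp add: leaves_def C.leaf_set_def vertex_degree_eq)
  moreover have "undirected_tree ?T"
    using C.sptree_undirected_tree [OF E \<open>pverts G \<noteq> {}\<close>] .
  moreover have "spanning (with_proj ?T) (with_proj G)"
  proof -
    have "wf_digraph (with_proj ?T)"
      unfolding wf_digraph_wp_iff using C.sptreeD(7) [OF E] by unfold_locales auto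
    then show ?thesis
      using C.sptreeD(1) [OF E] wf_digraph by (auto simp: spanning_def subgraph_def compatible_def)
  qed
  ultimately show ?thesis
    by (auto simp: spanning_k_ended_tree_def k_ended_tree_def)
qed

end
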